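(* Fix integers $m$ and $d$ with $-|m|/2<d\leqslant |m|/2$. Then there is a unique $z\in\mathbb C$ with $m-1/2<\operatorname{Re}(z)<m+1/2$ and $z\notin(-i\infty,m]$ such that $p_d'(z)=0$. This solution $z^*$ is given by $$z^*=m+\frac{\log\bigl(1-w(d,-m)\bigr)}{2\pi i}$$ and satisfies $p_d(z^* )=\log\bigl(w(d,-m)\bigr)$.
   Context: $\operatorname{Li}_2$ is the principal branch of the dilogarithm (holomorphic on $\mathbb C\setminus[1,\infty)$, $\operatorname{Li}_2(z)=\sum_{n\ge1}z^n/n^2$ for $|z|\le1$), $\log$ is the principal logarithm, and for $n\in\mathbb Z$, $(-i\infty,n]$ denotes the set of points with real part $n$ and imaginary part $\le 0$. For $d\in\mathbb Z$, $p_d(z):=\dfrac{-\operatorname{Li}_2(e^{2\pi i z})+\operatorname{Li}_2(1)+4\pi^2 d}{2\pi i z}$, holomorphic away from $0$ and the lines $(-i\infty,n]$, $n\in\mathbb Z$. For integers $A,B$ with $B\neq0$ and $-|B|/2<A\le|B|/2$, $w(A,B)$ denotes the unique solution $z\in\mathbb C\setminus((-\infty,0]\cup[1,\infty))$ of $\operatorname{Li}_2(z)+4\pi^2A+2\pi i B\log z=0$ (such a unique solution exists for exactly these $A,B$). *)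

theory Defs
  imports "HOL-Complex_Analysis.Complex_Analysis"
begin

text \<open>
  Principal branch of the dilogarithm: the power series on the closed unit disc, continued
  to the plane slit along \<open>[1,\<infinity>)\<close> by integrating \<open>- log (1 - u) / u\<close> along the segment from
  the origin. Lemmas \<open>dilog_sums\<close> and \<open>dilog_holomorphic\<close> below state the two characterising
  properties. On the cut beyond \<open>1\<close> the value carries no meaning.
\<close>

definition dilog :: "complex \<Rightarrow> complex" where
  "dilog z = (if norm z \<le> 1 then (\<Sum>n. z ^ Suc n / of_nat (Suc n) ^ 2)
              else contour_integral (linepath 0 z) (\<lambda>u. - Ln (1 - u) / u))"

definition p_fun :: "int \<Rightarrow> complex \<Rightarrow> complex" where
  "p_fun d z = (- dilog (exp (2 * of_real pi * \<i> * z)) + dilog 1 + 4 * (of_real pi)\<^sup>2 * of_int d)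
             / (2 * of_real pi * \<i> * z)"

definition down_ray :: "int \<Rightarrow> complex set" where
  "down_ray n = {z. Re z = of_int n \<and> Im z \<le> 0}"

definition saddle_strip :: "int \<Rightarrow> complex set" where
  "saddle_strip m = {z. of_int m - 1 / 2 < Re z \<and> Re z < of_int m + 1 / 2 \<and> z \<notin> down_ray m}"

definition dilog_zero_domain :: "complex set" where
  "dilog_zero_domain = - (complex_of_real ` ({..0} \<union> {1..}))"

text \<open>
  Only meaningful when \<open>B \<noteq> 0\<close> and \<open>- \<bar>B\<bar> / 2 < A \<le> \<bar>B\<bar> / 2\<close>, which is exactly when the zero
  exists and is unique.
\<close>

definition dilog_zero :: "int \<Rightarrow> int \<Rightarrow> complex" where
  "dilog_zero A B = (THE z. z \<in> dilog_zero_domain \<and>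
      dilog z + 4 * (of_real pi)\<^sup>2 * of_int A + 2 * of_real pi * \<i> * of_int B * Ln z = 0)"

lemma dilog_summable:
  assumes "norm z \<le> 1"
  shows "summable (\<lambda>n. z ^ Suc n / of_nat (Suc n) ^ 2 :: complex)"
proof (rule summable_comparison_test)
  show "summable (\<lambda>n. 1 / real (Suc n) ^ 2)"
    using inverse_power_summable[of 2, where 'a = real] summable_Suc_iff[of "\<lambda>n. 1 / real n ^ 2"]
    by (simp add: field_simps)
  show "\<exists>N. \<forall>n\<ge>N. norm (z ^ Suc n / of_nat (Suc n) ^ 2) \<le> 1 / real (Suc n) ^ 2"
    using assms by (auto simp: norm_divide norm_power simp del: of_nat_Suc power_Suc
        intro!: divide_right_mono power_le_one)
qed

lemma dilog_sums:
  assumes "norm z \<le> 1"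
  shows "(\<lambda>n. z ^ Suc n / of_nat (Suc n) ^ 2) sums dilog z"
  using dilog_summable[OF assms] assms by (simp add: dilog_def summable_sums)

lemma dilog_continuous_on_cball: "continuous_on (cball 0 1) dilog"
proof -
  have sm: "summable (\<lambda>n. 1 / real (Suc n) ^ 2)"
    using inverse_power_summable[of 2, where 'a = real] summable_Suc_iff[of "\<lambda>n. 1 / real n ^ 2"]
    by (simp add: field_simps)
  have "uniform_limit (cball 0 1) (\<lambda>n z. \<Sum>i<n. z ^ Suc i / of_nat (Suc i) ^ 2)
          (\<lambda>z. \<Sum>i. z ^ Suc i / of_nat (Suc i) ^ 2 :: complex) sequentially"
    by (rule Weierstrass_m_test[OF _ sm])
      (auto simp: norm_divide norm_power simp del: of_nat_Suc power_Suc
        intro!: divide_right_mono power_le_one)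
  then have "continuous_on (cball 0 1) (\<lambda>z. \<Sum>i. z ^ Suc i / of_nat (Suc i) ^ 2 :: complex)"
    by (rule uniform_limit_theorem[rotated])
      (auto intro!: always_eventually continuous_intros simp del: of_nat_Suc power_Suc)
  then show ?thesis
    by (rule continuous_on_eq) (auto simp: dilog_def)
qed

lemma dilog_has_field_derivative_ball:
  assumes "norm z < 1" "z \<noteq> 0"
  shows "(dilog has_field_derivative - Ln (1 - z) / z) (at z)"
proof -
  define c :: "nat \<Rightarrow> complex" where "c n = 1 / of_nat n ^ 2" for n
  have sm: "summable (\<lambda>n. c n * x ^ n)" if "norm x < 1" for x
    using dilog_summable[of x] that summable_Suc_iff[of "\<lambda>n. c n * x ^ n"]
    by (simp add: c_def field_simps)
  have eq: "(\<Sum>n. c n * x ^ n) = dilog x" if "norm x < 1" for x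
    using suminf_split_head[OF sm[OF that]] that
    by (simp add: c_def dilog_def field_simps)
  have "((\<lambda>x. \<Sum>n. c n * x ^ n) has_field_derivative (\<Sum>n. diffs c n * z ^ n)) (at z)"
    using termdiffs_strong'[of 1 c z] sm assms by auto
  moreover have "(\<lambda>n. diffs c n * z ^ n) sums (- Ln (1 - z) / z)"
  proof -
    have "(\<lambda>n. (-1) ^ Suc n / of_nat n * (- z) ^ n) sums Ln (1 + (- z))"
      by (rule Ln_series) (use assms in auto)
    then have "(\<lambda>n. (-1) ^ Suc (Suc n) / of_nat (Suc n) * (- z) ^ Suc n) sums Ln (1 - z)"
      by (subst sums_Suc_iff) simp
    then have "(\<lambda>n. - ((-1) ^ Suc (Suc n) / of_nat (Suc n) * (- z) ^ Suc n) / z) sums (- Ln (1 - z) / z)"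
      by (intro sums_divide sums_minus)
    moreover have "- ((-1) ^ Suc (Suc n) / of_nat (Suc n) * (- z) ^ Suc n) / z = diffs c n * z ^ n" for n
    proof -
      have "(- z) ^ Suc n = (-1) ^ Suc n * z ^ Suc n"
        by (metis power_minus)
      moreover have "(-1) ^ Suc (Suc n) * (-1) ^ Suc n = (-1 :: complex)"
        by (simp flip: power_add power_mult_distrib)
      ultimately have "- ((-1) ^ Suc (Suc n) / of_nat (Suc n) * (- z) ^ Suc n) / z
          = z ^ Suc n / of_nat (Suc n) / z"
        by (simp add: field_simps flip: power_mult_distrib)
      also have "\<dots> = diffs c n * z ^ n"
        using assms(2) by (simp add: diffs_def c_def power2_eq_square del: of_nat_Suc)
      finally show ?thesis .
    qed
    ultimately show ?thesis by (simp only:)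
  qed
  ultimately have "((\<lambda>x. \<Sum>n. c n * x ^ n) has_field_derivative (- Ln (1 - z) / z)) (at z)"
    by (simp add: sums_iff)
  then show ?thesis
    by (rule has_field_derivative_transform_within_open[where S = "ball 0 1"])
      (use assms eq in \<open>auto simp: dist_norm\<close>)
qed

lemma closed_dilog_cut: "closed (complex_of_real ` {1..})"
proof -
  have "complex_of_real ` {1..} = {z. Im z = 0} \<inter> {z. Re z \<ge> 1}"
    by (auto simp: image_iff complex_eq_iff)
  then show ?thesis
    by (simp add: closed_Collect_eq closed_Collect_le continuous_on_Re continuous_on_Im closed_Int)
qed

lemma dilog_primitive:
  obtains F where
    "\<And>z. z \<notin> complex_of_real ` {1..} \<Longrightarrow> (F has_field_derivative
        (if z = 0 then 1 else - Ln (1 - z) / z)) (at z)"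
    "\<And>z. z \<notin> complex_of_real ` {1..} \<Longrightarrow> dilog z = F z"
proof -
  define S :: "complex set" where "S = - complex_of_real ` {1..}"
  define g :: "complex \<Rightarrow> complex" where "g z = (if z = 0 then 1 else - Ln (1 - z) / z)" for z
  have S_alt: "S = {z. 1 - z \<notin> \<real>\<^sub>\<le>\<^sub>0}"
    by (auto simp: S_def complex_nonpos_Reals_iff image_iff complex_eq_iff)
  have "open S"
    unfolding S_def by (intro open_Compl closed_dilog_cut)
  have S0: "0 \<in> S" by (auto simp: S_def)
  have seg: "closed_segment 0 z \<subseteq> S" if "z \<in> S" for z
  proof
    fix x assume "x \<in> closed_segment 0 z"
    then obtain t where t: "x = of_real t * z" "0 \<le> t" "t \<le> 1"
      by (auto simp: in_segment scaleR_conv_of_real)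
    show "x \<in> S"
    proof (rule ccontr)
      assume "x \<notin> S"
      then have x: "Im x = 0" "Re x \<ge> 1" by (auto simp: S_def)
      then have "t > 0" using t by (cases "t = 0") auto
      then have "Im z = 0" "t * Re z \<ge> 1" using x t by auto
      moreover from this have "Re z \<ge> 1"
        using \<open>t > 0\<close> t by (smt (verit) mult_left_le_one_le mult_nonneg_nonpos)
      ultimately show False using that
        by (auto simp: S_def image_iff complex_eq_iff)
    qed
  qed
  have star: "starlike S" using S0 seg by (auto simp: starlike_def)
  have fd: "g field_differentiable at x" if "x \<in> S - {0}" for x
  proof -
    have "((\<lambda>z. - Ln (1 - z) / z) has_field_derivative
        (- ((- (inverse (1 - x) * x) - Ln (1 - x)) / (x * x)))) (at x)"
      using that by (auto simp: S_alt intro!: derivative_eq_intros)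
    then have "(g has_field_derivative
        (- ((- (inverse (1 - x) * x) - Ln (1 - x)) / (x * x)))) (at x)"
      by (rule has_field_derivative_transform_within_open[where S = "- {0}"])
        (use that in \<open>auto simp: g_def\<close>)
    then show ?thesis
      by (auto simp: field_differentiable_def)
  qed
  have "continuous_on S g"
  proof (rule continuous_at_imp_continuous_on, rule ballI)
    fix x assume "x \<in> S"
    show "isCont g x"
    proof (cases "x = 0")
      case False
      then show ?thesis using fd[of x] \<open>x \<in> S\<close> field_differentiable_imp_continuous_at by blast
    next
      case True
      have "((\<lambda>z. - Ln (1 - z)) has_field_derivative 1) (at 0)"
        by (auto intro!: derivative_eq_intros)
      then have "(\<lambda>z. - Ln (1 - z) / z) \<midarrow>0\<rightarrow> 1"
        by (simp add: has_field_derivative_iff)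
      then have "g \<midarrow>0\<rightarrow> 1"
        by (rule Lim_transform_eventually) (auto simp: g_def eventually_at intro!: exI[of _ 1])
      then show ?thesis using True by (simp add: isCont_def g_def)
    qed
  qed
  from holomorphic_starlike_primitive[OF this star \<open>open S\<close> finite.insertI[OF finite.emptyI] fd]
  obtain G where G: "\<And>x. x \<in> S \<Longrightarrow> (G has_field_derivative g x) (at x)" by blast
  define F where "F z = G z - G 0" for z
  have F: "(F has_field_derivative g x) (at x)" if "x \<in> S" for x
    unfolding F_def using G[OF that] by (auto intro!: derivative_eq_intros)
  have int: "contour_integral (linepath 0 z) (\<lambda>u. - Ln (1 - u) / u) = F z" if "z \<in> S" for z
  proof (cases "z = 0")
    case False
    have "(g has_contour_integral F z - F 0) (linepath 0 z)"
      using contour_integral_primitive[of S F g "linepath 0 z"] F seg[OF that]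
      by (auto simp: has_field_derivative_at_within)
    then have "((\<lambda>t. g (linepath 0 z t) * (z - 0)) has_integral F z) {0..1}"
      by (simp add: has_contour_integral_linepath F_def)
    then have "((\<lambda>t. (\<lambda>u. - Ln (1 - u) / u) (linepath 0 z t) * (z - 0)) has_integral F z) {0..1}"
      by (rule has_integral_spike_finite[of "{0}", rotated 2])
        (use False in \<open>auto simp: g_def linepath_def\<close>)
    then have "((\<lambda>u. - Ln (1 - u) / u) has_contour_integral F z) (linepath 0 z)"
      by (simp only: has_contour_integral_linepath)
    then show ?thesis
      by (rule contour_integral_unique)
  qed (simp add: F_def)
  have ball: "dilog z = F z" if "norm z < 1" for z
  proof -
    have inS: "x \<in> S" if "norm x < 1" for x
      using that by (auto simp: S_def)
    have cd: "continuous_on (ball 0 1) dilog"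
      by (rule continuous_on_subset[OF dilog_continuous_on_cball]) auto
    have cF: "continuous_on (ball 0 1) F"
      by (auto intro!: continuous_at_imp_continuous_on DERIV_isCont F inS)
    have "\<exists>c. \<forall>x \<in> ball 0 1. dilog x - F x = c"
    proof (rule DERIV_zero_connected_constant[of "ball 0 1" "{0}" "\<lambda>x. dilog x - F x", THEN exE])
      show "\<forall>x\<in>ball 0 1 - {0}. ((\<lambda>x. dilog x - F x) has_field_derivative 0) (at x)"
      proof
        fix x :: complex assume x: "x \<in> ball 0 1 - {0}"
        then have "((\<lambda>x. dilog x - F x) has_field_derivative (- Ln (1 - x) / x - g x)) (at x)"
          by (intro DERIV_diff dilog_has_field_derivative_ball F inS) auto
        then show "((\<lambda>x. dilog x - F x) has_field_derivative 0) (at x)"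
          using x by (simp add: g_def)
      qed
    qed (auto intro!: continuous_on_diff cd cF)
    then obtain c where c: "\<And>x. norm x < 1 \<Longrightarrow> dilog x - F x = c" by auto
    from c[of 0] have "c = 0" by (simp add: F_def dilog_def)
    with c[OF that] show ?thesis by simp
  qed
  have eq: "dilog z = F z" if "z \<in> S" for z
  proof (cases "norm z \<le> 1")
    case False
    then show ?thesis using int[OF that] by (simp add: dilog_def)
  next
    case True
    let ?X = "(\<lambda>n. of_real (1 - 1 / real (Suc (Suc n))) * z)"
    have lim: "?X \<longlonglongrightarrow> z"
    proof -
      have "(\<lambda>n. 1 - 1 / real (Suc (Suc n))) \<longlonglongrightarrow> 1 - 0"
        by (intro tendsto_diff tendsto_const LIMSEQ_Suc lim_1_over_n)
      then have "?X \<longlonglongrightarrow> of_real (1 - 0) * z"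
        by (intro tendsto_mult tendsto_of_real tendsto_const)
      then show ?thesis by simp
    qed
    have lt: "norm (?X n) < 1" for n
    proof -
      have "norm (?X n) = (1 - 1 / real (Suc (Suc n))) * norm z"
        by (simp add: norm_mult del: of_real_diff)
      also have "\<dots> \<le> 1 - 1 / real (Suc (Suc n))"
        using True by (intro mult_left_le) auto
      also have "\<dots> < 1" by simp
      finally show ?thesis .
    qed
    have "(\<lambda>n. dilog (?X n)) \<longlonglongrightarrow> dilog z"
      by (rule continuous_on_tendsto_compose[OF dilog_continuous_on_cball lim])
        (use True lt in \<open>auto intro!: always_eventually less_imp_le\<close>)
    moreover have "(\<lambda>n. F (?X n)) \<longlonglongrightarrow> F z"
      by (rule isCont_tendsto_compose[OF DERIV_isCont[OF F[OF that]] lim])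
    ultimately show ?thesis using ball[OF lt] LIMSEQ_unique by simp
  qed
  show ?thesis
    by (rule that[of F]) (use F eq in \<open>auto simp: S_def g_def\<close>)
qed

lemma dilog_has_field_derivative:
  assumes "z \<notin> complex_of_real ` {1..}"
  shows "(dilog has_field_derivative (if z = 0 then 1 else - Ln (1 - z) / z)) (at z)"
proof -
  obtain F where F: "\<And>z. z \<notin> complex_of_real ` {1..} \<Longrightarrow> (F has_field_derivative
        (if z = 0 then 1 else - Ln (1 - z) / z)) (at z)"
    "\<And>z. z \<notin> complex_of_real ` {1..} \<Longrightarrow> dilog z = F z"
    using dilog_primitive by blast
  have "open (- complex_of_real ` {1..})"
    by (intro open_Compl closed_dilog_cut)
  from has_field_derivative_transform_within_open[OF F(1)[OF assms] this] show ?thesis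
    using F(2) assms by auto
qed

lemma dilog_holomorphic: "dilog holomorphic_on - complex_of_real ` {1..}"
  using dilog_has_field_derivative
  by (meson ComplD field_differentiable_at_within field_differentiable_def holomorphic_on_def)

end

theory Submission
  imports Defs "HOL-Real_Asymp.Real_Asymp"
begin

text \<open>
  Put \<open>w = 1 - e\<^bsup>2\<pi>iz\<^esup>\<close>. The reflection formula for the dilogarithm turns \<open>p\<^sub>d'(z) = 0\<close> into
  \<open>Li\<^sub>2(w) + 4\<pi>\<^sup>2d - 2\<pi>im log w = 0\<close>, so everything rests on existence and uniqueness of \<open>w(A, B)\<close>,
  where complex conjugation reduces to \<open>B > 0\<close>.

  In the coordinate \<open>s = log w\<close> the function \<open>h(s) = Li\<^sub>2(e\<^sup>s) + 2\<pi>iBs\<close> has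
  \<open>Im h' = 2\<pi>B - arg(1 - e\<^sup>s) > 0\<close>. It is therefore injective on each of the convex half strips
  \<open>0 < Im s < \<pi>\<close> and \<open>-\<pi> < Im s < 0\<close>, and comparison with the boundary value \<open>h(0) = \<pi>\<^sup>2/6\<close> shows
  that a real level of \<open>h\<close> is attained in only one of them.

  For existence in the upper half strip, \<open>Im h(x + i\<theta>)\<close> increases with \<open>x\<close> and vanishes at a
  point \<open>x(\<theta>)\<close> of \<open>[-1, 0]\<close>. The intermediate value theorem applied to \<open>Re h\<close> along this curve
  gives every level between its values at \<open>\<theta> = 0\<close> and \<open>\<theta> = \<pi>\<close>. The lower half strip is
  reduced to the upper one by the inversion formula.
\<close>

section \<open>The doubly slit plane\<close>

lemma dilog_zero_domain_iff: "z \<in> dilog_zero_domain \<longleftrightarrow> z \<notin> \<real>\<^sub>\<le>\<^sub>0 \<and> 1 - z \<notin> \<real>\<^sub>\<le>\<^sub>0"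
  by (auto simp: dilog_zero_domain_def complex_nonpos_Reals_iff image_iff complex_eq_iff)

lemma one_minus_in_dilog_zero_domain_iff:
  "1 - z \<in> dilog_zero_domain \<longleftrightarrow> z \<in> dilog_zero_domain"
  by (auto simp: dilog_zero_domain_iff)

lemma cnj_in_dilog_zero_domain_iff: "cnj z \<in> dilog_zero_domain \<longleftrightarrow> z \<in> dilog_zero_domain"
  by (auto simp: dilog_zero_domain_iff complex_nonpos_Reals_iff)

lemma open_dilog_zero_domain: "open dilog_zero_domain"
proof -
  have "dilog_zero_domain = - \<real>\<^sub>\<le>\<^sub>0 \<inter> (\<lambda>z. 1 - z) -` (- \<real>\<^sub>\<le>\<^sub>0)"
    by (auto simp: dilog_zero_domain_iff)
  moreover have "open ((\<lambda>z. 1 - z) -` (- \<real>\<^sub>\<le>\<^sub>0 :: complex set))"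
    by (intro open_vimage continuous_intros) auto
  ultimately show ?thesis
    by (metis open_Int open_Compl closed_nonpos_Reals_complex)
qed

text \<open>The set is star-shaped about 1/2: a point other than 1/2 on a segment from there is real
  only if the far end is real, and that end then lies in (0, 1).\<close>

lemma connected_dilog_zero_domain: "connected dilog_zero_domain"
proof (rule starlike_imp_connected, unfold starlike_def, intro bexI ballI subsetI)
  show half: "1/2 \<in> dilog_zero_domain"
    by (auto simp: dilog_zero_domain_iff complex_nonpos_Reals_iff)
  fix z x :: complex
  assume z: "z \<in> dilog_zero_domain" and "x \<in> closed_segment (1/2) z"
  then obtain t where t: "x = (1 - t) *\<^sub>R (1/2) + t *\<^sub>R z" "0 \<le> t" "t \<le> 1"
    by (auto simp: in_segment)
  show "x \<in> dilog_zero_domain"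
  proof (cases "Im x = 0")
    case False
    then show ?thesis by (auto simp: dilog_zero_domain_iff complex_nonpos_Reals_iff)
  next
    case True
    show ?thesis
    proof (cases "t = 0")
      case True
      with t have "x = 1/2" by (simp add: scaleR_conv_of_real)
      with half show ?thesis by (simp only:)
    next
      case False
      with True t have "Im z = 0" by auto
      with z have "0 < Re z" "Re z < 1"
        by (auto simp: dilog_zero_domain_iff complex_nonpos_Reals_iff)
      moreover have "t * Re z < t * 1"
        using \<open>Re z < 1\<close> False t by (intro mult_strict_left_mono) auto
      moreover have "0 < t * Re z"
        using \<open>0 < Re z\<close> False t by simp
      moreover have "2 * Re x = 1 - t + 2 * (t * Re z)"
        using t by (simp add: Re_divide_numeral)
      ultimately have "0 < Re x \<and> Re x < 1"
        using \<open>t \<le> 1\<close> by linarith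
      then show ?thesis
        by (auto simp: dilog_zero_domain_iff complex_nonpos_Reals_iff)
    qed
  qed
qed

section \<open>Derivative, special values and conjugation of the dilogarithm\<close>

lemma dilog_has_field_derivative_slit:
  assumes "1 - z \<notin> \<real>\<^sub>\<le>\<^sub>0" "z \<noteq> 0"
  shows "(dilog has_field_derivative - Ln (1 - z) / z) (at z)"
proof -
  have "z \<notin> complex_of_real ` {1..}"
    using assms by (auto simp: complex_nonpos_Reals_iff)
  from dilog_has_field_derivative[OF this] assms(2) show ?thesis by simp
qed

lemma dilog_exp_has_field_derivative:
  assumes "1 - exp s \<notin> \<real>\<^sub>\<le>\<^sub>0"
  shows "((\<lambda>s. dilog (exp s)) has_field_derivative - Ln (1 - exp s)) (at s)"
  using DERIV_chain2[OF dilog_has_field_derivative_slit[OF assms] DERIV_exp] by simp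

lemma dilog_0 [simp]: "dilog 0 = 0"
  by (simp add: dilog_def)

lemma sums_pi_squared_over_6: "(\<lambda>n. 1 / real (Suc n) ^ 2) sums (pi\<^sup>2 / 6)"
  using inverse_squares_sums by (simp add: add.commute)

lemma dilog_1: "dilog 1 = of_real (pi\<^sup>2 / 6)"
proof -
  have "(\<lambda>n. of_real (1 / real (Suc n) ^ 2) :: complex) sums of_real (pi\<^sup>2 / 6)"
    by (rule sums_of_real[OF sums_pi_squared_over_6])
  then have "(\<lambda>n. 1 ^ Suc n / of_nat (Suc n) ^ 2 :: complex) sums of_real (pi\<^sup>2 / 6)"
    by simp
  moreover have "(\<lambda>n. 1 ^ Suc n / of_nat (Suc n) ^ 2 :: complex) sums dilog 1"
    by (rule dilog_sums) simp
  ultimately show ?thesis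
    by (rule sums_unique2[symmetric])
qed

lemma norm_dilog_le:
  assumes "norm z \<le> 1"
  shows "norm (dilog z) \<le> pi\<^sup>2 / 6"
proof -
  have "norm (\<Sum>n. z ^ Suc n / of_nat (Suc n) ^ 2) \<le> (\<Sum>n. 1 / real (Suc n) ^ 2)"
    by (rule norm_suminf_le)
      (use assms sums_summable[OF sums_pi_squared_over_6] in
        \<open>auto simp: norm_divide norm_power simp del: of_nat_Suc power_Suc
          intro!: divide_right_mono power_le_one\<close>)
  then show ?thesis
    using sums_unique[OF dilog_sums[OF assms]] sums_unique[OF sums_pi_squared_over_6] by simp
qed

text \<open>The definition of \<open>dilog\<close> by cases calls for two arguments: the series has
  real coefficients, and outside the disc the integrand commutes with conjugation along a segment
  that avoids the cut. The alternative \<open>norm z \<le> 1\<close> adds only the point 1.\<close>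

lemma dilog_cnj:
  assumes "1 - z \<notin> \<real>\<^sub>\<le>\<^sub>0 \<or> norm z \<le> 1"
  shows "dilog (cnj z) = cnj (dilog z)"
proof (cases "norm z \<le> 1")
  case True
  have "(\<lambda>n. cnj (z ^ Suc n / of_nat (Suc n) ^ 2)) sums cnj (dilog z)"
    using dilog_sums[OF True] by (simp only: sums_cnj)
  then have "(\<lambda>n. cnj z ^ Suc n / of_nat (Suc n) ^ 2) sums cnj (dilog z)"
    by (simp del: of_nat_Suc power_Suc)
  moreover have "(\<lambda>n. cnj z ^ Suc n / of_nat (Suc n) ^ 2) sums dilog (cnj z)"
    by (rule dilog_sums) (use True in simp)
  ultimately show ?thesis
    by (rule sums_unique2[symmetric])
next
  case False
  with assms have z: "1 - z \<notin> \<real>\<^sub>\<le>\<^sub>0" by simp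
  have eq: "cnj (- Ln (1 - cnj u) / cnj u) = - Ln (1 - u) / u" if "1 - u \<notin> \<real>\<^sub>\<le>\<^sub>0" for u
    using cnj_Ln[OF that] by (metis complex_cnj_cnj complex_cnj_diff complex_cnj_divide complex_cnj_minus complex_cnj_one)
  have seg: "1 - u \<notin> \<real>\<^sub>\<le>\<^sub>0" if u: "u \<in> path_image (linepath 0 z)" for u
  proof
    assume neg: "1 - u \<in> \<real>\<^sub>\<le>\<^sub>0"
    from u obtain t where t: "u = of_real t * z" "0 \<le> t" "t \<le> 1"
      by (auto simp: in_segment scaleR_conv_of_real)
    with neg have *: "t * Re z \<ge> 1" "t * Im z = 0" by (auto simp: complex_nonpos_Reals_iff)
    then have "t \<noteq> 0" by auto
    with * have "Im z = 0" by simp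
    moreover have "Re z \<ge> 1"
      using * t by (smt (verit) mult_left_le_one_le mult_nonneg_nonpos)
    ultimately show False
      using z by (auto simp: complex_nonpos_Reals_iff)
  qed
  have "dilog (cnj z) = contour_integral (cnj \<circ> linepath 0 z) (\<lambda>u. - Ln (1 - u) / u)"
    using False by (simp add: dilog_def linepath_cnj')
  also have "\<dots> = cnj (contour_integral (linepath 0 z) (\<lambda>u. cnj (- Ln (1 - cnj u) / cnj u)))"
    by (subst contour_integral_cnj) (auto simp: o_def)
  also have "contour_integral (linepath 0 z) (\<lambda>u. cnj (- Ln (1 - cnj u) / cnj u))
      = contour_integral (linepath 0 z) (\<lambda>u. - Ln (1 - u) / u)"
    by (rule contour_integral_eq) (rule eq[OF seg])
  finally show ?thesis
    using False by (simp add: dilog_def)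
qed

section \<open>Reflection formula and the boundary value at 1\<close>

text \<open>\<open>Ln v\<close> grows only logarithmically in the norm of v, while
  \<open>Ln (1 - v)\<close> is at most twice that norm near 0.\<close>

lemma tendsto_Ln_mult_Ln_0: "((\<lambda>v. Ln v * Ln (1 - v)) \<longlongrightarrow> 0) (at 0)"
proof (rule tendsto_0_le[where K = 1])
  have "((\<lambda>x. (- ln x + pi) * (2 * x)) \<longlongrightarrow> 0) (at_right 0)"
    by real_asymp
  moreover have "filterlim (\<lambda>v::complex. norm v) (at_right 0) (at 0)"
    by (auto simp: filterlim_at eventually_at intro!: tendsto_eq_intros exI[of _ 1])
  ultimately show "((\<lambda>v::complex. (- ln (norm v) + pi) * (2 * norm v)) \<longlongrightarrow> 0) (at 0)"
    by (rule filterlim_compose)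
  have "norm (Ln v * Ln (1 - v)) \<le> norm ((- ln (norm v) + pi) * (2 * norm v))"
    if v: "v \<noteq> 0" "norm v < 1/2" for v
  proof -
    have "norm (Ln v) \<le> \<bar>Re (Ln v)\<bar> + \<bar>Im (Ln v)\<bar>"
      by (rule cmod_le)
    also have "\<dots> \<le> - ln (norm v) + pi"
      using v Im_Ln_le_pi[of v] mpi_less_Im_Ln[of v] by (auto simp: abs_if ln_less_zero_iff)
    finally have "norm (Ln v) \<le> - ln (norm v) + pi" .
    moreover have "norm (Ln (1 - v)) \<le> 2 * norm v"
      using norm_Ln_le[of "- v"] v by simp
    ultimately have "norm (Ln v) * norm (Ln (1 - v)) \<le> (- ln (norm v) + pi) * (2 * norm v)"
      by (rule mult_mono) (use \<open>norm (Ln v) \<le> - ln (norm v) + pi\<close> norm_ge_zero[of "Ln v"] in linarith, simp)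
    then show ?thesis
      by (simp add: norm_mult)
  qed
  then show "\<forall>\<^sub>F v in at 0. norm (Ln v * Ln (1 - v)) \<le> norm ((- ln (norm v) + pi) * (2 * norm v)) * 1"
    by (auto simp: eventually_at intro!: exI[of _ "1/2"])
qed

text \<open>The left side has derivative 0 on the connected domain, hence is constant; letting z
  tend to 0 identifies the constant.\<close>

lemma dilog_reflection:
  assumes "z \<in> dilog_zero_domain"
  shows "dilog z + dilog (1 - z) + Ln z * Ln (1 - z) = dilog 1"
proof -
  let ?F = "\<lambda>z. dilog z + dilog (1 - z) + Ln z * Ln (1 - z)"
  have der: "(?F has_field_derivative 0) (at x)" if x: "x \<in> dilog_zero_domain" for x
  proof -
    have x': "x \<notin> \<real>\<^sub>\<le>\<^sub>0" "1 - x \<notin> \<real>\<^sub>\<le>\<^sub>0" "x \<noteq> 0" "1 - x \<noteq> 0"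
      using x by (auto simp: dilog_zero_domain_iff)
    have 1: "(dilog has_field_derivative - Ln (1 - x) / x) (at x)"
      by (rule dilog_has_field_derivative_slit) (use x' in auto)
    have 2: "(dilog has_field_derivative - Ln (1 - (1 - x)) / (1 - x)) (at (1 - x))"
      by (rule dilog_has_field_derivative_slit) (use x' in auto)
    have "((\<lambda>z. dilog (1 - z)) has_field_derivative - Ln (1 - (1 - x)) / (1 - x) * (0 - 1)) (at x)"
      by (rule DERIV_chain2[where f = dilog and g = "\<lambda>z. 1 - z", OF 2]) (auto intro!: derivative_eq_intros)
    moreover have "((\<lambda>z. Ln z * Ln (1 - z)) has_field_derivative
        (inverse x * Ln (1 - x) - inverse (1 - x) * Ln x)) (at x)"
      using x' by (auto intro!: derivative_eq_intros)
    ultimately have "(?F has_field_derivative (- Ln (1 - x) / x + - Ln (1 - (1 - x)) / (1 - x) * (0 - 1)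
        + (inverse x * Ln (1 - x) - inverse (1 - x) * Ln x))) (at x)"
      by (rule DERIV_add[OF DERIV_add[OF 1]])
    then show ?thesis
      using x' by (simp add: field_simps)
  qed
  then have "continuous_on dilog_zero_domain ?F"
    by (intro continuous_at_imp_continuous_on ballI DERIV_isCont)
  then obtain c where c: "\<And>x. x \<in> dilog_zero_domain \<Longrightarrow> ?F x = c"
    using DERIV_zero_connected_constant[OF connected_dilog_zero_domain open_dilog_zero_domain
        finite.emptyI, of ?F] der by auto
  \<comment> \<open>Continuity up to the point 1 is so far known only on the closed unit disc, so
    the limit is taken along real x in (0, 1), where x and 1 - x both stay in that disc.\<close>
  have cont: "((\<lambda>x. dilog (f x)) \<longlongrightarrow> dilog y) (at_right 0)"
    if "(f \<longlongrightarrow> y) (at_right (0::real))" "norm y \<le> 1" "\<forall>\<^sub>F x in at_right 0. norm (f x) \<le> 1" for f y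
    by (rule continuous_on_tendsto_compose[OF dilog_continuous_on_cball that(1)])
      (use that in auto)
  have small: "\<forall>\<^sub>F x in at_right (0::real). 0 < x \<and> x < 1"
    by (rule eventually_at_rightI[of 0 1]) auto
  have of_real: "filterlim complex_of_real (at 0) (at_right 0)"
    by (auto simp: filterlim_at eventually_at intro!: tendsto_eq_intros exI[of _ 1])
  have "((\<lambda>x. complex_of_real x) \<longlongrightarrow> of_real 0) (at_right 0)"
    by (intro tendsto_intros)
  then have lim0: "((\<lambda>x. dilog (of_real x)) \<longlongrightarrow> dilog 0) (at_right 0)"
    by (intro cont) (use eventually_mono[OF small] in auto)
  have "((\<lambda>x. 1 - complex_of_real x) \<longlongrightarrow> 1 - of_real 0) (at_right 0)"
    by (intro tendsto_intros)
  moreover have "norm (1 - complex_of_real x) \<le> 1" if "0 < x \<and> x < 1" for x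
    using that norm_of_real[of "1 - x", where 'a = complex] by simp
  then have "\<forall>\<^sub>F x in at_right 0. norm (1 - complex_of_real x) \<le> 1"
    by (rule eventually_mono[OF small])
  ultimately have lim1: "((\<lambda>x. dilog (1 - of_real x)) \<longlongrightarrow> dilog 1) (at_right 0)"
    using cont[of "\<lambda>x. 1 - complex_of_real x" 1] by simp
  have "((\<lambda>x. Ln (of_real x) * Ln (1 - of_real x)) \<longlongrightarrow> 0) (at_right 0)"
    using filterlim_compose[OF tendsto_Ln_mult_Ln_0 of_real] .
  from tendsto_add[OF tendsto_add[OF lim0 lim1] this]
  have "((\<lambda>x. ?F (of_real x)) \<longlongrightarrow> dilog 0 + dilog 1 + 0) (at_right 0)" .
  moreover have "\<forall>\<^sub>F x in at_right 0. ?F (of_real x) = c"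
    using small by eventually_elim (rule c, auto simp: dilog_zero_domain_iff complex_nonpos_Reals_iff)
  ultimately have "((\<lambda>x::real. c) \<longlongrightarrow> dilog 1) (at_right 0)"
    by (simp add: tendsto_cong)
  then have "c = dilog 1"
    by (simp add: tendsto_const_iff)
  with c[OF assms] show ?thesis by simp
qed

text \<open>Continuity on the closed disc does not cover an approach to 1 from outside it.
  Reflection moves the approach to 0, where \<open>dilog\<close> is differentiable.\<close>

lemma dilog_tendsto_1: "(dilog \<longlongrightarrow> dilog 1) (at 1 within dilog_zero_domain)"
proof -
  have flt: "filterlim (\<lambda>z. 1 - z :: complex) (at 0) (at 1 within dilog_zero_domain)"
    by (auto simp: filterlim_at eventually_at intro!: tendsto_eq_intros exI[of _ 1])
  have "isCont dilog 0"
    using dilog_has_field_derivative[of 0] by (intro DERIV_isCont[of _ 1]) (simp add: image_iff)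
  then have "((\<lambda>z. dilog (1 - z)) \<longlongrightarrow> 0) (at 1 within dilog_zero_domain)"
    using filterlim_compose[OF _ flt, of dilog "nhds 0"] by (simp add: isCont_def)
  then have "((\<lambda>z. dilog 1 - dilog (1 - z) - Ln (1 - z) * Ln (1 - (1 - z))) \<longlongrightarrow> dilog 1 - 0 - 0)
      (at 1 within dilog_zero_domain)"
    by (intro tendsto_diff tendsto_const filterlim_compose[OF tendsto_Ln_mult_Ln_0 flt])
  then have "((\<lambda>z. dilog 1 - dilog (1 - z) - Ln (1 - z) * Ln (1 - (1 - z))) \<longlongrightarrow> dilog 1)
      (at 1 within dilog_zero_domain)"
    by simp
  then show ?thesis
  proof (rule Lim_transform_eventually)
    show "\<forall>\<^sub>F z in at 1 within dilog_zero_domain.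
        dilog 1 - dilog (1 - z) - Ln (1 - z) * Ln (1 - (1 - z)) = dilog z"
      using dilog_reflection by (auto simp: eventually_at_filter algebra_simps)
  qed
qed

text \<open>
  With \<open>a = 1\<close> this is the Noshiro--Warschawski argument: a function whose derivative has
  positive imaginary part on a convex set is injective there.
\<close>

lemma Im_difference_quotient_pos:
  fixes h h' :: "complex \<Rightarrow> complex"
  assumes "x \<noteq> y"
    and der: "\<And>s. s \<in> open_segment x y \<Longrightarrow> (h has_field_derivative h' s) (at s)"
    and pos: "\<And>s. s \<in> open_segment x y \<Longrightarrow> 0 < Im (a * h' s)"
    and cont: "continuous_on (closed_segment x y) h"
  shows "0 < Im (a * ((h y - h x) / (y - x)))"
proof -
  \<comment> \<open>The division by \<open>y - x\<close> cancels the chain-rule factor, so that the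
    derivative of \<open>f\<close> is the imaginary part of \<open>a * h'\<close> on the
    segment.\<close>
  define f where "f t = Im (a / (y - x) * h (linepath x y t))" for t
  have "f 0 < f 1"
  proof (rule DERIV_pos_imp_increasing_open[of 0 1 f])
    show "continuous_on {0..1} f"
      unfolding f_def
      by (intro continuous_intros continuous_on_compose2[OF cont])
        (auto simp: path_image_linepath[unfolded path_image_def, symmetric])
    fix t :: real assume t: "0 < t" "t < 1"
    then have s: "linepath x y t \<in> open_segment x y"
      using \<open>x \<noteq> y\<close> by (auto simp: in_segment linepath_def)
    have "((h \<circ> linepath x y) has_vector_derivative (y - x) * h' (linepath x y t)) (at t)"
      by (rule field_vector_diff_chain_at[OF has_vector_derivative_linepath_within der[OF s]])
    then have "((\<lambda>t. Im (a / (y - x) * h (linepath x y t))) has_vector_derivative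
        Im (a / (y - x) * ((y - x) * h' (linepath x y t)))) (at t)"
      unfolding o_def
      by (intro bounded_linear.has_vector_derivative[OF bounded_linear_Im] has_vector_derivative_mult_right)
    then have "(f has_real_derivative Im (a * h' (linepath x y t))) (at t)"
      using \<open>x \<noteq> y\<close> unfolding f_def has_real_derivative_iff_has_vector_derivative by simp
    with pos[OF s] show "\<exists>y. (f has_real_derivative y) (at t) \<and> 0 < y"
      by blast
  qed simp
  then show ?thesis
    by (simp add: f_def linepath_0' linepath_1' algebra_simps diff_divide_distrib)
qed

section \<open>Exponential coordinates and signs of the dilogarithm\<close>

lemma exp_in_dilog_zero_domain:
  assumes "0 < \<bar>Im s\<bar>" "\<bar>Im s\<bar> < pi"
  shows "exp s \<in> dilog_zero_domain"
proof -
  have "sin (Im s) \<noteq> 0"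
    using assms sin_gt_zero[of "Im s"] sin_gt_zero[of "- Im s"] by (auto simp: abs_if split: if_splits)
  then have "Im (exp s) \<noteq> 0"
    by (simp add: Im_exp)
  then show ?thesis
    by (auto simp: dilog_zero_domain_iff complex_nonpos_Reals_iff)
qed

lemma one_minus_exp_not_nonpos_Reals:
  assumes "Re s < 0"
  shows "1 - exp s \<notin> \<real>\<^sub>\<le>\<^sub>0"
proof -
  have "Re (exp s) \<le> norm (exp s)"
    by (rule complex_Re_le_cmod)
  also have "\<dots> < 1"
    using assms by simp
  finally show ?thesis
    by (simp add: complex_nonpos_Reals_iff)
qed

lemma Im_dilog_real:
  assumes "Im z = 0" "norm z \<le> 1"
  shows "Im (dilog z) = 0"
proof -
  have "cnj z = z"
    using assms by (simp add: complex_eq_iff)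
  with dilog_cnj[of z] assms show ?thesis
    by (metis complex_cnj_cancel_iff complex_is_Real_iff Reals_cnj_iff)
qed

lemma Im_dilog_nonneg:
  assumes "0 \<le> Im z" "norm z \<le> 1"
  shows "0 \<le> Im (dilog z)"
proof (cases "Im z = 0")
  case True
  with assms Im_dilog_real show ?thesis by simp
next
  case False
  then have z: "Im z > 0" "z \<noteq> 0"
    using assms by auto
  have seg: "\<exists>t. s = of_real t * z \<and> 0 < t \<and> t < 1" if "s \<in> open_segment 0 z" for s
    using that by (auto simp: in_segment scaleR_conv_of_real)
  \<comment> \<open>The weight \<open>a = z\<close> undoes the division by z, leaving
    \<open>dilog z\<close>. On the radius \<open>s = t * z\<close> it turns the derivative into
    \<open>- Ln (1 - s) / t\<close> with t real and positive, whose sign is that of - arg(1 -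
    s).\<close>
  have "0 < Im (z * ((dilog z - dilog 0) / (z - 0)))"
  proof (rule Im_difference_quotient_pos)
    fix s assume "s \<in> open_segment 0 z"
    from seg[OF this] obtain t where t: "s = of_real t * z" "0 < t" "t < 1"
      by blast
    then have Im: "Im (1 - s) < 0"
      using z by simp
    then have "1 - s \<notin> \<real>\<^sub>\<le>\<^sub>0" "s \<noteq> 0"
      by (auto simp: complex_nonpos_Reals_iff)
    then show "(dilog has_field_derivative - Ln (1 - s) / s) (at s)"
      by (rule dilog_has_field_derivative_slit)
    have "Im (Ln (1 - s)) < 0"
      using Im Im_Ln_pos_le[of "1 - s"] Im_Ln_le_pi[of "1 - s"] by (cases "1 - s = 0") auto
    moreover have "z * (- Ln (1 - s) / s) = - Ln (1 - s) / of_real t"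
      using t z by (simp add: field_simps)
    then have "Im (z * (- Ln (1 - s) / s)) = - Im (Ln (1 - s)) / t"
      by (simp only: Im_divide_of_real uminus_complex.sel)
    ultimately show "0 < Im (z * (- Ln (1 - s) / s))"
      using t by (simp only: divide_pos_pos neg_0_less_iff_less)
  next
    have "closed_segment 0 z \<subseteq> cball 0 1"
      using assms by (intro closed_segment_subset) auto
    then show "continuous_on (closed_segment 0 z) dilog"
      by (rule continuous_on_subset[OF dilog_continuous_on_cball])
  qed (use z in auto)
  with z show ?thesis by simp
qed

lemma Re_dilog_minus_one_neg: "Re (dilog (-1)) < 0"
proof -
  \<comment> \<open>The weight \<open>\<i>\<close> converts the imaginary part into a real part; on
    the segment the derivative is the positive number ln(1 + t)/t.\<close>
  have "0 < Im (\<i> * ((dilog (-1) - dilog 0) / (-1 - 0)))"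
  proof (rule Im_difference_quotient_pos)
    fix s :: complex assume "s \<in> open_segment 0 (-1)"
    then obtain t where t: "s = - of_real t" "0 < t" "t < 1"
      by (auto simp: in_segment scaleR_conv_of_real)
    then have "1 - s = of_real (1 + t)" by simp
    with t have Ln: "Ln (1 - s) = of_real (ln (1 + t))"
      using Ln_of_real[of "1 + t"] by (simp only:)
    have "1 - s \<notin> \<real>\<^sub>\<le>\<^sub>0" "s \<noteq> 0"
      using t by (auto simp: complex_nonpos_Reals_iff)
    then show "(dilog has_field_derivative - Ln (1 - s) / s) (at s)"
      by (intro dilog_has_field_derivative_slit)
    have "\<i> * (- Ln (1 - s) / s) = \<i> * of_real (ln (1 + t) / t)"
      unfolding Ln using t by simp
    then have "Im (\<i> * (- Ln (1 - s) / s)) = ln (1 + t) / t"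
      by (simp only: Im_i_times Re_complex_of_real)
    then show "0 < Im (\<i> * (- Ln (1 - s) / s))"
      using t by simp
  next
    have "closed_segment 0 (-1 :: complex) \<subseteq> cball 0 1"
      by (intro closed_segment_subset) auto
    then show "continuous_on (closed_segment 0 (-1 :: complex)) dilog"
      by (rule continuous_on_subset[OF dilog_continuous_on_cball])
  qed auto
  then show ?thesis by simp
qed

text \<open>
  The equation defining \<open>w(A, B)\<close> is a level of \<open>dilog_phase 0 (2B)\<close> at \<open>s = log w\<close>; the inversion
  \<open>s \<mapsto> -s\<close> carries it to a level of \<open>dilog_phase 1 (2B - 1)\<close>.
\<close>

definition dilog_phase :: "real \<Rightarrow> real \<Rightarrow> complex \<Rightarrow> complex" where
  "dilog_phase c n s = dilog (exp s) + of_real c * s\<^sup>2 / 2 + \<i> * of_real (pi * n) * s"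

section \<open>Derivative of the phase and uniqueness of its real levels\<close>

lemma dilog_phase_has_field_derivative:
  assumes "1 - exp s \<notin> \<real>\<^sub>\<le>\<^sub>0"
  shows "(dilog_phase c n has_field_derivative
    - Ln (1 - exp s) + of_real c * s + \<i> * of_real (pi * n)) (at s)"
proof -
  have "((\<lambda>s. of_real c * s\<^sup>2 / 2 + \<i> * of_real (pi * n) * s) has_field_derivative
      of_real c * s + \<i> * of_real (pi * n)) (at s)"
    by (auto intro!: derivative_eq_intros)
  from DERIV_add[OF dilog_exp_has_field_derivative[OF assms] this] show ?thesis
    unfolding dilog_phase_def[abs_def] add.assoc .
qed

text \<open>Off the cut arg(1 - e^s) is strictly below pi, and \<open>pi * n\<close> is at least
  pi.\<close>

lemma Im_dilog_phase_derivative_pos: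
  assumes "1 - exp s \<notin> \<real>\<^sub>\<le>\<^sub>0" "0 \<le> c * Im s" "1 \<le> n"
  shows "0 < Im (1 * (- Ln (1 - exp s) + of_real c * s + \<i> * of_real (pi * n)))"
proof -
  have "pi * 1 \<le> pi * n"
    using assms by (intro mult_left_mono) auto
  moreover have "Im (1 * (- Ln (1 - exp s) + of_real c * s + \<i> * of_real (pi * n)))
      = - Im (Ln (1 - exp s)) + c * Im s + pi * n"
    by simp
  ultimately show ?thesis
    using Im_Ln_less_pi[OF assms(1)] assms(2) by linarith
qed

lemma dilog_phase_eq_zero_iff:
  assumes "z \<noteq> 0"
  shows "dilog z + 4 * (of_real pi)\<^sup>2 * of_int A + 2 * of_real pi * \<i> * of_int B * Ln z = 0
    \<longleftrightarrow> dilog_phase 0 (2 * of_int B) (Ln z) = of_real (- 4 * pi\<^sup>2 * of_int A)"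
proof -
  have "dilog z + 4 * (of_real pi)\<^sup>2 * of_int A + 2 * of_real pi * \<i> * of_int B * Ln z
      = dilog_phase 0 (2 * of_int B) (Ln z) - of_real (- 4 * pi\<^sup>2 * of_int A)"
    using assms by (simp add: dilog_phase_def)
  then show ?thesis
    by (simp only: right_minus_eq)
qed

text \<open>Compares a value with the boundary value pi^2/6 at \<open>s = 0\<close>: for a real
  level this fixes the sign of \<open>Im s\<close>. The segment from 0 to s runs inside one half
  strip except for its end 0, where continuity is enough.\<close>

lemma Im_dilog_phase_quotient_pos:
  assumes s: "0 < \<bar>Im s\<bar>" "\<bar>Im s\<bar> < pi" and "1 \<le> n"
  shows "0 < Im ((dilog_phase 0 n s - of_real (pi\<^sup>2 / 6)) / s)"
proof -
  let ?h = "dilog_phase 0 n"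
  have seg: "exp x \<in> dilog_zero_domain \<and> exp x \<noteq> 1" if x: "x \<in> closed_segment 0 s" "x \<noteq> 0" for x
  proof -
    from x obtain t where t: "x = of_real t * s" "0 \<le> t" "t \<le> 1"
      by (auto simp: in_segment scaleR_conv_of_real)
    with x have "0 < t" by (cases "t = 0") auto
    moreover have "t * \<bar>Im s\<bar> \<le> 1 * \<bar>Im s\<bar>"
      using t by (intro mult_right_mono) auto
    then have "\<bar>t * Im s\<bar> < pi"
      using t s(2) unfolding abs_mult by linarith
    ultimately have "exp x \<in> dilog_zero_domain"
      using t s by (intro exp_in_dilog_zero_domain) auto
    then show ?thesis
      by (auto simp: dilog_zero_domain_iff)
  qed
  have "continuous (at x within closed_segment 0 s) ?h" if x: "x \<in> closed_segment 0 s" for x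
  proof (cases "x = 0")
    case False
    then have "isCont ?h x"
      using seg[OF x] by (intro DERIV_isCont[OF dilog_phase_has_field_derivative])
        (auto simp: dilog_zero_domain_iff)
    then show ?thesis
      by (rule continuous_at_imp_continuous_at_within)
  next
    case True
    \<comment> \<open>For \<open>Re s > 0\<close> the image of the segment leaves the unit disc, so
      the limit at 1 has to be the one within the slit plane.\<close>
    have "filterlim exp (at 1 within dilog_zero_domain) (at 0 within closed_segment 0 s)"
    proof -
      have "(exp \<longlongrightarrow> exp 0) (at (0::complex) within closed_segment 0 s)"
        by (intro tendsto_intros)
      then show ?thesis
        unfolding filterlim_at using seg by (auto simp: eventually_at_filter)
    qed
    from filterlim_compose[OF dilog_tendsto_1 this]
    have "((\<lambda>x. dilog (exp x) + \<i> * of_real (pi * n) * x) \<longlongrightarrow> dilog 1 + \<i> * of_real (pi * n) * 0)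
        (at 0 within closed_segment 0 s)"
      by (intro tendsto_intros)
    then show ?thesis
      using True by (simp add: continuous_within dilog_phase_def[abs_def])
  qed
  then have cont: "continuous_on (closed_segment 0 s) ?h"
    by (simp add: continuous_on_eq_continuous_within)
  have "0 < Im (1 * ((?h s - ?h 0) / (s - 0)))"
  proof (rule Im_difference_quotient_pos[OF _ _ _ cont])
    fix x assume "x \<in> open_segment 0 s"
    then have x: "1 - exp x \<notin> \<real>\<^sub>\<le>\<^sub>0"
      using seg[of x] by (auto simp: open_segment_def dilog_zero_domain_iff)
    show "(?h has_field_derivative - Ln (1 - exp x) + of_real 0 * x + \<i> * of_real (pi * n)) (at x)"
      by (rule dilog_phase_has_field_derivative[OF x])
    show "0 < Im (1 * (- Ln (1 - exp x) + of_real 0 * x + \<i> * of_real (pi * n)))"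
      by (rule Im_dilog_phase_derivative_pos[OF x]) (use \<open>1 \<le> n\<close> in auto)
  qed (use s in auto)
  then show ?thesis
    by (simp add: dilog_phase_def dilog_1)
qed

text \<open>The factor \<open>\<sigma>\<close> encodes a common nonzero sign of the two imaginary
  parts, which treats both half strips at once.\<close>

lemma dilog_phase_inj_same_sign:
  assumes "\<bar>Im x\<bar> < pi" "\<bar>Im y\<bar> < pi" "0 < \<sigma> * Im x" "0 < \<sigma> * Im y" "1 \<le> n"
    and eq: "dilog_phase 0 n x = dilog_phase 0 n y"
  shows "x = y"
proof (rule ccontr)
  assume "x \<noteq> y"
  let ?h = "dilog_phase 0 n"
  have seg: "1 - exp s \<notin> \<real>\<^sub>\<le>\<^sub>0" if "s \<in> closed_segment x y" for s
  proof -
    have conv: "closed_segment x y \<subseteq> {s. Im s < pi}" "closed_segment x y \<subseteq> {s. Im s > - pi}"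
      by (intro closed_segment_subset convex_halfspace_Im_lt convex_halfspace_Im_gt;
          use assms in \<open>simp add: abs_less_iff\<close>)+
    have "closed_segment x y \<subseteq> {s. Im s > 0} \<or> closed_segment x y \<subseteq> {s. Im s < 0}"
    proof (cases "0 < \<sigma>")
      case True
      then have "closed_segment x y \<subseteq> {s. Im s > 0}"
        using assms by (intro closed_segment_subset convex_halfspace_Im_gt)
          (auto simp: zero_less_mult_iff)
      then show ?thesis ..
    next
      case False
      then have "closed_segment x y \<subseteq> {s. Im s < 0}"
        using assms by (intro closed_segment_subset convex_halfspace_Im_lt)
          (auto simp: zero_less_mult_iff)
      then show ?thesis ..
    qed
    with conv that have "Im s < pi" "- pi < Im s" "Im s \<noteq> 0"
      by auto
    then have "exp s \<in> dilog_zero_domain"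
      by (intro exp_in_dilog_zero_domain) (auto simp: abs_less_iff)
    then show ?thesis by (simp add: dilog_zero_domain_iff)
  qed
  have "0 < Im (1 * ((?h y - ?h x) / (y - x)))"
  proof (rule Im_difference_quotient_pos[OF \<open>x \<noteq> y\<close>])
    fix s assume "s \<in> open_segment x y"
    then have s: "1 - exp s \<notin> \<real>\<^sub>\<le>\<^sub>0"
      using seg[of s] by (auto simp: open_segment_def)
    show "(?h has_field_derivative - Ln (1 - exp s) + of_real 0 * s + \<i> * of_real (pi * n)) (at s)"
      by (rule dilog_phase_has_field_derivative[OF s])
    show "0 < Im (1 * (- Ln (1 - exp s) + of_real 0 * s + \<i> * of_real (pi * n)))"
      by (rule Im_dilog_phase_derivative_pos[OF s]) (use \<open>1 \<le> n\<close> in auto)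
  next
    show "continuous_on (closed_segment x y) ?h"
      using seg by (intro continuous_at_imp_continuous_on ballI)
        (blast intro: DERIV_isCont dilog_phase_has_field_derivative)
  qed
  with eq show False by simp
qed

lemma dilog_phase_real_level_unique:
  assumes "x \<in> dilog_zero_domain" "y \<in> dilog_zero_domain" "1 \<le> n"
    and eq: "dilog_phase 0 n (Ln x) = of_real \<tau>" "dilog_phase 0 n (Ln y) = of_real \<tau>"
  shows "x = y"
proof -
  have sign: "\<bar>Im (Ln z)\<bar> < pi \<and> 0 < (pi\<^sup>2 / 6 - \<tau>) * Im (Ln z)"
    if z: "z \<in> dilog_zero_domain" and eq: "dilog_phase 0 n (Ln z) = of_real \<tau>" for z
  proof -
    have z': "z \<notin> \<real>\<^sub>\<le>\<^sub>0" "1 - z \<notin> \<real>\<^sub>\<le>\<^sub>0" "z \<noteq> 0"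
      using z by (auto simp: dilog_zero_domain_iff)
    have lt: "\<bar>Im (Ln z)\<bar> < pi"
      using Im_Ln_less_pi[OF z'(1)] mpi_less_Im_Ln[OF z'(3)] by (simp add: abs_less_iff)
    \<comment> \<open>A real logarithm would place z in (0, 1), where \<open>dilog\<close> is real
      and the linear term has negative imaginary part, contradicting a real level.\<close>
    have nz: "Im (Ln z) \<noteq> 0"
    proof
      assume "Im (Ln z) = 0"
      then have z01: "0 < Re z" "Im z = 0" "Re z < 1"
        using z' Im_Ln_eq_0[of z] by (auto simp: complex_nonpos_Reals_iff)
      then have "norm z < 1" "0 < norm z"
        by (auto simp: cmod_def)
      then have "Im (dilog z) = 0" "ln (norm z) < 0"
        using z01 by (auto intro: Im_dilog_real)
      moreover have "Im (dilog_phase 0 n (Ln z)) = Im (dilog z) + pi * n * ln (norm z)"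
        using z' by (simp add: dilog_phase_def)
      moreover have "pi * n > 0"
        using \<open>1 \<le> n\<close> by simp
      ultimately have "Im (dilog_phase 0 n (Ln z)) < 0"
        by (simp add: mult_pos_neg)
      with eq show False by simp
    qed
    \<comment> \<open>The quotient of a real number by \<open>Ln z\<close> reveals the sign of
      \<open>Im (Ln z)\<close>, which thus depends on \<open>\<tau>\<close> alone: all solutions lie
      in the same half strip.\<close>
    have "0 < Im ((of_real \<tau> - of_real (pi\<^sup>2 / 6)) / Ln z)"
      using Im_dilog_phase_quotient_pos[of "Ln z" n] lt nz \<open>1 \<le> n\<close> eq by simp
    also have "\<dots> = (pi\<^sup>2 / 6 - \<tau>) * Im (Ln z) / (norm (Ln z))\<^sup>2"
      by (simp add: Im_divide cmod_power2 algebra_simps)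
    finally show ?thesis
      using lt by (simp add: zero_less_divide_iff)
  qed
  have "dilog_phase 0 n (Ln x) = dilog_phase 0 n (Ln y)"
    by (simp only: eq)
  then have "Ln x = Ln y"
    using sign[OF assms(1) eq(1)] sign[OF assms(2) eq(2)] \<open>1 \<le> n\<close>
      dilog_phase_inj_same_sign[of "Ln x" "Ln y" "pi\<^sup>2 / 6 - \<tau>" n]
    by blast
  then have "exp (Ln x) = exp (Ln y)"
    by (simp only:)
  moreover have "x \<noteq> 0" "y \<noteq> 0"
    using assms by (auto simp: dilog_zero_domain_iff)
  ultimately show ?thesis
    by simp
qed

section \<open>Existence of real levels in the upper half strip\<close>

lemma continuous_on_dilog_phase: "continuous_on {s. Re s \<le> 0} (dilog_phase c n)"
proof -
  have "continuous_on {s. Re s \<le> 0} (\<lambda>s. dilog (exp s))"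
    by (rule continuous_on_compose2[OF dilog_continuous_on_cball])
      (auto intro!: continuous_intros)
  then show ?thesis
    unfolding dilog_phase_def[abs_def] by (intro continuous_intros) auto
qed

text \<open>Left of the imaginary axis e^s lies inside the unit disc, so the derivative bound holds
  on the horizontal segment; its right end may touch the axis, where continuity suffices.\<close>

lemma Im_dilog_phase_strict_mono:
  assumes "x < y" "y \<le> 0" "0 \<le> \<theta>" "0 \<le> c" "1 \<le> n"
  shows "Im (dilog_phase c n (Complex x \<theta>)) < Im (dilog_phase c n (Complex y \<theta>))"
proof -
  let ?h = "dilog_phase c n"
  have seg: "Im s = \<theta> \<and> Re s \<le> 0 \<and> (s \<noteq> Complex y \<theta> \<longrightarrow> Re s < 0)"
    if "s \<in> closed_segment (Complex x \<theta>) (Complex y \<theta>)" for s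
  proof -
    from that have s: "Im s = \<theta>" "Re s \<in> closed_segment x y"
      by (auto simp: closed_segment_same_Im)
    with assms show ?thesis
      by (auto simp: closed_segment_eq_real_ivl complex_eq_iff)
  qed
  have "0 < Im (1 * ((?h (Complex y \<theta>) - ?h (Complex x \<theta>)) / (Complex y \<theta> - Complex x \<theta>)))"
  proof (rule Im_difference_quotient_pos)
    fix s assume "s \<in> open_segment (Complex x \<theta>) (Complex y \<theta>)"
    then have s: "Im s = \<theta>" "Re s < 0"
      using seg[of s] by (auto simp: open_segment_def)
    then have *: "1 - exp s \<notin> \<real>\<^sub>\<le>\<^sub>0"
      by (intro one_minus_exp_not_nonpos_Reals)
    show "(?h has_field_derivative - Ln (1 - exp s) + of_real c * s + \<i> * of_real (pi * n)) (at s)"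
      by (rule dilog_phase_has_field_derivative[OF *])
    show "0 < Im (1 * (- Ln (1 - exp s) + of_real c * s + \<i> * of_real (pi * n)))"
      by (rule Im_dilog_phase_derivative_pos[OF *]) (use assms s in auto)
  next
    show "continuous_on (closed_segment (Complex x \<theta>) (Complex y \<theta>)) ?h"
      by (rule continuous_on_subset[OF continuous_on_dilog_phase]) (use seg in auto)
  qed (use assms in auto)
  moreover have "Complex y \<theta> - Complex x \<theta> = of_real (y - x)"
    by (simp add: complex_eq_iff)
  ultimately have "0 < Im (?h (Complex y \<theta>) - ?h (Complex x \<theta>)) / (y - x)"
    by (simp only: Im_divide_of_real mult_1)
  with \<open>x < y\<close> show ?thesis
    by (simp add: zero_less_divide_iff)
qed

lemma Im_dilog_phase:
  "Im (dilog_phase c n (Complex x \<theta>)) = Im (dilog (exp (Complex x \<theta>))) + c * x * \<theta> + pi * n * x"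
  by (simp add: dilog_phase_def power2_eq_square)

lemma Re_dilog_phase:
  "Re (dilog_phase c n (Complex x \<theta>)) =
    Re (dilog (exp (Complex x \<theta>))) + c * (x\<^sup>2 - \<theta>\<^sup>2) / 2 - pi * n * \<theta>"
  by (simp add: dilog_phase_def power2_eq_square)

text \<open>The two bounds on \<open>\<tau>\<close> are the values of the real part at the ends of
  the curve of vanishing imaginary part. Admitting \<open>c > 0\<close> lets the same argument serve
  after inversion.\<close>

lemma dilog_phase_real_level_exists:
  assumes "0 \<le> c" "1 \<le> n" "\<tau> < pi\<^sup>2 / 6" "Re (dilog (-1)) - c * pi\<^sup>2 / 2 - pi\<^sup>2 * n < \<tau>"
  obtains s where "0 < Im s" "Im s < pi" "dilog_phase c n s = of_real \<tau>"
proof -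
  define P where "P \<theta> x = Im (dilog_phase c n (Complex x \<theta>))" for \<theta> x
  define R where "R = ({0..pi} \<times> {-1..0} :: (real \<times> real) set)"
  have cont: "continuous_on R (\<lambda>p. dilog_phase c n (Complex (snd p) (fst p)))"
    by (rule continuous_on_compose2[OF continuous_on_dilog_phase])
      (auto simp: R_def intro!: continuous_intros)
  have mono: "P \<theta> x < P \<theta> y" if "x < y" "y \<le> 0" "0 \<le> \<theta>" for \<theta> x y
    unfolding P_def using that assms by (intro Im_dilog_phase_strict_mono)
  have "\<exists>x. x \<in> {-1..0} \<and> P \<theta> x = 0" if \<theta>: "\<theta> \<in> {0..pi}" for \<theta>
  proof -
    \<comment> \<open>Abscissa -1 is far enough left: there the linear term is - pi n, while the
      dilogarithm contributes at most pi^2/6 < pi.\<close>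
    have "norm (dilog (exp (Complex (-1) \<theta>))) \<le> pi\<^sup>2 / 6"
      by (rule norm_dilog_le) simp
    then have "Im (dilog (exp (Complex (-1) \<theta>))) \<le> pi * pi / 6"
      using abs_Im_le_cmod[of "dilog (exp (Complex (-1) \<theta>))"] by (simp add: power2_eq_square)
    also have "\<dots> \<le> pi * 4 / 6"
      using pi_less_4 by (intro divide_right_mono mult_left_mono) auto
    also have "\<dots> < pi * 1"
      using pi_gt_zero by (simp del: pi_gt_zero)
    also have "\<dots> \<le> pi * n"
      using assms by (intro mult_left_mono) auto
    finally have "Im (dilog (exp (Complex (-1) \<theta>))) < pi * n" .
    moreover have "0 \<le> c * \<theta>"
      using assms \<theta> by simp
    ultimately have lo: "P \<theta> (-1) \<le> 0"
      by (simp add: P_def Im_dilog_phase)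
    have "0 \<le> Im (dilog (exp (Complex 0 \<theta>)))"
      using \<theta> by (intro Im_dilog_nonneg) (auto simp: Im_exp intro!: sin_ge_zero)
    then have hi: "0 \<le> P \<theta> 0"
      by (simp add: P_def Im_dilog_phase)
    have "continuous_on {-1..0} (\<lambda>x. dilog_phase c n (Complex (snd (\<theta>, x)) (fst (\<theta>, x))))"
      by (rule continuous_on_compose2[OF cont, of _ "\<lambda>x. (\<theta>, x)"])
        (use \<theta> in \<open>auto simp: R_def intro!: continuous_intros\<close>)
    then have "continuous_on {-1..0} (P \<theta>)"
      unfolding P_def by (intro continuous_intros) simp
    with IVT'[of "P \<theta>" "-1" 0 0] lo hi show ?thesis
      by auto
  qed
  then obtain g where g: "\<And>\<theta>. \<theta> \<in> {0..pi} \<Longrightarrow> g \<theta> \<in> {-1..0} \<and> P \<theta> (g \<theta>) = 0"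
    by metis
  have g_unique: "x = g \<theta>" if "\<theta> \<in> {0..pi}" "x \<in> {-1..0}" "P \<theta> x = 0" for \<theta> x
  proof (rule ccontr)
    assume "x \<noteq> g \<theta>"
    then consider "x < g \<theta>" | "g \<theta> < x" by linarith
    then show False
      using mono[of x "g \<theta>" \<theta>] mono[of "g \<theta>" x \<theta>] g[OF that(1)] that by cases auto
  qed
  \<comment> \<open>By uniqueness of the zero, the graph of \<open>g\<close> is the whole closed
    zero set in the rectangle; a closed graph with values in a compact set gives continuity.\<close>
  have "continuous_on {0..pi} g"
  proof (rule continuous_from_closed_graph[of "{-1..0}"])
    have "(\<lambda>\<theta>. (\<theta>, g \<theta>)) ` {0..pi} = {p \<in> R. Im (dilog_phase c n (Complex (snd p) (fst p))) = 0}"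
      using g g_unique by (auto simp: R_def P_def image_iff)
    moreover have "closed {p \<in> R. Im (dilog_phase c n (Complex (snd p) (fst p))) = 0}"
      by (rule continuous_closed_preimage_constant)
        (use cont in \<open>auto simp: R_def intro!: continuous_intros closed_Times\<close>)
    ultimately show "closed ((\<lambda>\<theta>. (\<theta>, g \<theta>)) ` {0..pi})"
      by simp
  qed (use g in auto)
  then have "continuous_on {0..pi} (\<lambda>\<theta>. dilog_phase c n (Complex (snd (\<theta>, g \<theta>)) (fst (\<theta>, g \<theta>))))"
    by (intro continuous_on_compose2[OF cont, of _ "\<lambda>\<theta>. (\<theta>, g \<theta>)"])
      (use g in \<open>auto simp: R_def intro!: continuous_intros\<close>)
  then have cont_Re: "continuous_on {0..pi} (\<lambda>\<theta>. Re (dilog_phase c n (Complex (g \<theta>) \<theta>)))"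
    by (intro continuous_intros) simp
  have e0: "exp (Complex 0 0) = 1" and epi: "exp (Complex 0 pi) = -1"
    by (auto simp: complex_eq_iff Re_exp Im_exp)
  \<comment> \<open>At both angles the exponential is real, 1 or -1, so the curve starts and ends on
    the imaginary axis.\<close>
  have "0 = g 0" "0 = g pi"
    by (rule g_unique; simp add: P_def Im_dilog_phase e0 epi Im_dilog_real)+
  then have ends: "Re (dilog_phase c n (Complex (g 0) 0)) = pi\<^sup>2 / 6"
      "Re (dilog_phase c n (Complex (g pi) pi)) = Re (dilog (-1)) - c * pi\<^sup>2 / 2 - pi\<^sup>2 * n"
    by (simp_all add: Re_dilog_phase e0 epi dilog_1 power2_eq_square flip: \<open>0 = g 0\<close> \<open>0 = g pi\<close>)
  obtain \<theta> where \<theta>: "0 \<le> \<theta>" "\<theta> \<le> pi" "Re (dilog_phase c n (Complex (g \<theta>) \<theta>)) = \<tau>"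
    using IVT2'[of "\<lambda>\<theta>. Re (dilog_phase c n (Complex (g \<theta>) \<theta>))" pi \<tau> 0] cont_Re ends assms
    by auto
  with ends assms have "\<theta> \<noteq> 0" "\<theta> \<noteq> pi"
    by auto
  moreover have "Im (dilog_phase c n (Complex (g \<theta>) \<theta>)) = 0"
    using g[of \<theta>] \<theta> by (simp add: P_def)
  ultimately show ?thesis
    using \<theta> that[of "Complex (g \<theta>) \<theta>"] by (simp add: complex_eq_iff)
qed

section \<open>Inversion formula and existence of w(A, B)\<close>

text \<open>The derivative vanishes on the strip because the two logarithms differ by i pi - s; the
  constant is the limit at 0, twice \<open>dilog 1\<close>.\<close>

lemma dilog_inversion:
  assumes "0 < Im t" "Im t < pi"
  shows "dilog (exp (- t)) + dilog (exp t) + t\<^sup>2 / 2 - \<i> * of_real pi * t = of_real (pi\<^sup>2 / 3)"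
proof -
  define S where "S = {s. 0 < Im s} \<inter> {s. Im s < pi}"
  let ?F = "\<lambda>s. dilog (exp (- s)) + dilog (exp s) + (s\<^sup>2 / 2 - \<i> * of_real pi * s)"
  have der: "(?F has_field_derivative 0) (at s)" if "s \<in> S" for s
  proof -
    have s: "0 < Im s" "Im s < pi"
      using that by (auto simp: S_def)
    then have ns: "1 - exp s \<notin> \<real>\<^sub>\<le>\<^sub>0" "1 - exp (- s) \<notin> \<real>\<^sub>\<le>\<^sub>0"
      using exp_in_dilog_zero_domain[of s] exp_in_dilog_zero_domain[of "- s"]
      by (auto simp: dilog_zero_domain_iff)
    then have nz: "1 - exp s \<noteq> 0"
      by auto
    have "Im (1 - exp s) < 0"
      using s by (simp add: Im_exp sin_gt_zero)
    then have "Im (Ln (1 - exp s)) < 0"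
      using Im_Ln_pos_le[OF nz] Im_Ln_le_pi[OF nz] by auto
    moreover have "- pi < Im (Ln (1 - exp s))"
      using mpi_less_Im_Ln[OF nz] .
    moreover have "exp (Ln (1 - exp s) + \<i> * of_real pi - s) = 1 - exp (- s)"
      using nz by (simp add: exp_diff exp_add exp_minus field_simps)
    \<comment> \<open>Im Ln(1 - e^s) lies in (-pi, 0) and \<open>Im s\<close> in (0, pi), so the
      right side stays in the principal strip.\<close>
    ultimately have Ln: "Ln (1 - exp (- s)) = Ln (1 - exp s) + \<i> * of_real pi - s"
      using s by (intro Ln_unique) auto
    have 1: "((\<lambda>s. dilog (exp (- s))) has_field_derivative - Ln (1 - exp (- s)) * - 1) (at s)"
      by (rule DERIV_chain2[where f = "\<lambda>s. dilog (exp s)" and g = uminus,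
            OF dilog_exp_has_field_derivative[OF ns(2)]])
        (auto intro!: derivative_eq_intros)
    have 2: "((\<lambda>s. s\<^sup>2 / 2 - \<i> * of_real pi * s) has_field_derivative s - \<i> * of_real pi) (at s)"
      by (auto intro!: derivative_eq_intros)
    from DERIV_add[OF DERIV_add[OF 1 dilog_exp_has_field_derivative[OF ns(1)]] 2]
    show ?thesis
      by (simp add: Ln)
  qed
  have "convex S" "open S"
    unfolding S_def by (intro convex_Int convex_halfspace_Im_gt convex_halfspace_Im_lt
        open_Int open_halfspace_Im_gt open_halfspace_Im_lt)+
  moreover have "continuous_on S ?F"
    using der by (intro continuous_at_imp_continuous_on ballI) (rule DERIV_isCont)
  ultimately obtain c where c: "\<And>s. s \<in> S \<Longrightarrow> ?F s = c"
    using DERIV_zero_connected_constant[of S "{}" ?F] der convex_connected by auto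
  \<comment> \<open>The point 0 is on the boundary of \<open>S\<close>. Along the imaginary axis
    both exponentials stay on the unit circle, so continuity on the closed disc gives the
    limit.\<close>
  have unit: "continuous_on UNIV (\<lambda>x. dilog (exp (\<i> * of_real (f x))))"
    if "continuous_on UNIV f" for f :: "real \<Rightarrow> real"
    by (rule continuous_on_compose2[OF dilog_continuous_on_cball])
      (use that in \<open>auto intro!: continuous_intros\<close>)
  have "continuous_on UNIV (\<lambda>x. dilog (exp (\<i> * of_real (- x))) + dilog (exp (\<i> * of_real x))
      + ((\<i> * of_real x)\<^sup>2 / 2 - \<i> * of_real pi * (\<i> * of_real x)))"
    by (intro continuous_on_add[OF continuous_on_add[OF unit unit]] continuous_intros) auto
  then have "continuous_on UNIV (\<lambda>x. ?F (\<i> * of_real x))"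
    by simp
  then have "isCont (\<lambda>x. ?F (\<i> * of_real x)) 0"
    by (simp only: continuous_on_eq_continuous_at[OF open_UNIV] UNIV_I ball_UNIV)
  then have "((\<lambda>x. ?F (\<i> * of_real x)) \<longlongrightarrow> ?F (\<i> * of_real 0)) (at_right 0)"
    unfolding isCont_def by (rule tendsto_within_subset) simp
  moreover have "\<forall>\<^sub>F x in at_right 0. ?F (\<i> * of_real x) = c"
  proof (rule eventually_at_rightI[of 0 pi])
    fix x assume "x \<in> {0<..<pi}"
    then have "\<i> * of_real x \<in> S"
      by (simp add: S_def)
    then show "?F (\<i> * of_real x) = c"
      by (rule c)
  qed simp
  ultimately have "((\<lambda>x::real. c) \<longlongrightarrow> ?F (\<i> * of_real 0)) (at_right 0)"
    by (rule Lim_transform_eventually)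
  then have "c = ?F (\<i> * of_real 0)"
    by (simp only: tendsto_const_iff trivial_limit_at_right_real not_False_eq_True)
  then have "c = of_real (pi\<^sup>2 / 3)"
    by (simp add: dilog_1)
  moreover have "?F t = c"
    using assms by (intro c) (simp add: S_def)
  ultimately show ?thesis
    by (simp only: add_diff_eq)
qed

text \<open>The level -4 pi^2 A is below pi^2/6 exactly when A is nonnegative, and then the upper
  half strip contains a solution. Otherwise the solution is sought as \<open>s = - t\<close> with t
  in the upper half strip.\<close>

lemma dilog_zero_exists_pos:
  assumes "0 < B" "- B < 2 * A" "2 * A \<le> B"
  obtains z where "z \<in> dilog_zero_domain"
    "dilog z + 4 * (of_real pi)\<^sup>2 * of_int A + 2 * of_real pi * \<i> * of_int B * Ln z = 0"
proof -
  have B: "1 \<le> real_of_int B" and AB: "2 * real_of_int A \<le> real_of_int B"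
    using assms by linarith+
  have mult_pi2: "pi\<^sup>2 * x \<le> pi\<^sup>2 * y" if "x \<le> y" for x y :: real
    using that by (intro mult_left_mono) auto
  have pi2: "0 < pi\<^sup>2" by simp
  show ?thesis
  proof (cases "0 \<le> A")
    case True
    have "0 \<le> pi\<^sup>2 * real_of_int A"
      using True by simp
    then have hi: "- 4 * pi\<^sup>2 * real_of_int A < pi\<^sup>2 / 6"
      using pi2 by linarith
    \<comment> \<open>In the extreme case 2A = B the strict inequality comes from
      \<open>Re (dilog (-1)) < 0\<close> alone.\<close>
    have "pi\<^sup>2 * (4 * real_of_int A) \<le> pi\<^sup>2 * (2 * real_of_int B)"
      by (rule mult_pi2) (use AB in simp)
    then have lo: "Re (dilog (-1)) - 0 * pi\<^sup>2 / 2 - pi\<^sup>2 * (2 * real_of_int B)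
        < - 4 * pi\<^sup>2 * real_of_int A"
      using Re_dilog_minus_one_neg by linarith
    obtain s where s: "0 < Im s" "Im s < pi"
      "dilog_phase 0 (2 * real_of_int B) s = of_real (- 4 * pi\<^sup>2 * of_int A)"
      using dilog_phase_real_level_exists[OF _ _ hi lo] B by auto
    from s have "Ln (exp s) = s"
      by simp
    moreover have "exp s \<in> dilog_zero_domain"
      using s by (intro exp_in_dilog_zero_domain) auto
    ultimately show ?thesis
      using that[of "exp s"] dilog_phase_eq_zero_iff[of "exp s" A B] s(3) by simp
  next
    case False
    have "pi\<^sup>2 * real_of_int A \<le> pi\<^sup>2 * - 1"
      by (rule mult_pi2) (use False in linarith)
    then have hi: "pi\<^sup>2 / 3 + 4 * pi\<^sup>2 * real_of_int A < pi\<^sup>2 / 6"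
      using pi2 by linarith
    \<comment> \<open>Integrality improves the strict bound by one, a margin that absorbs the pi^2/2
      and pi^2/3 terms.\<close>
    have "- real_of_int B + 1 \<le> 2 * real_of_int A"
      using assms by linarith
    then have "pi\<^sup>2 * (- 2 * real_of_int B + 2) \<le> pi\<^sup>2 * (4 * real_of_int A)"
      by (intro mult_pi2) simp
    then have lo: "Re (dilog (-1)) - 1 * pi\<^sup>2 / 2 - pi\<^sup>2 * (2 * real_of_int B - 1)
        < pi\<^sup>2 / 3 + 4 * pi\<^sup>2 * real_of_int A"
      using Re_dilog_minus_one_neg pi2 unfolding distrib_left right_diff_distrib by linarith
    obtain t where t: "0 < Im t" "Im t < pi"
      "dilog_phase 1 (2 * real_of_int B - 1) t = of_real (pi\<^sup>2 / 3 + 4 * pi\<^sup>2 * real_of_int A)"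
      using dilog_phase_real_level_exists[OF _ _ hi lo] B by auto
    have Ln: "Ln (exp (- t)) = - t"
      using t by (intro Ln_exp) auto
    \<comment> \<open>The term i pi t of the inversion formula lowers the slope 2B to 2B - 1, which
      is still at least 1.\<close>
    have "dilog (exp (- t)) + 4 * (of_real pi)\<^sup>2 * of_int A + 2 * of_real pi * \<i> * of_int B * (- t)
        = (dilog (exp (- t)) + dilog (exp t) + t\<^sup>2 / 2 - \<i> * of_real pi * t)
          + 4 * (of_real pi)\<^sup>2 * of_int A - dilog_phase 1 (2 * real_of_int B - 1) t"
      by (simp add: dilog_phase_def algebra_simps)
    also have "\<dots> = 0"
      by (simp add: dilog_inversion[OF t(1,2)] t(3))
    finally have "dilog (exp (- t)) + 4 * (of_real pi)\<^sup>2 * of_int A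
        + 2 * of_real pi * \<i> * of_int B * Ln (exp (- t)) = 0"
      by (simp only: Ln)
    moreover have "exp (- t) \<in> dilog_zero_domain"
      using t by (intro exp_in_dilog_zero_domain) auto
    ultimately show ?thesis
      using that by blast
  qed
qed

lemma dilog_zero_cnj:
  assumes z: "z \<in> dilog_zero_domain"
    and eq: "dilog z + 4 * (of_real pi)\<^sup>2 * of_int A + 2 * of_real pi * \<i> * of_int B * Ln z = 0"
  shows "dilog (cnj z) + 4 * (of_real pi)\<^sup>2 * of_int A
    + 2 * of_real pi * \<i> * of_int (- B) * Ln (cnj z) = 0"
proof -
  have "cnj (dilog z + 4 * (of_real pi)\<^sup>2 * of_int A + 2 * of_real pi * \<i> * of_int B * Ln z) = cnj 0"
    by (simp only: eq)
  moreover have "dilog (cnj z) = cnj (dilog z)" "Ln (cnj z) = cnj (Ln z)"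
    using z by (auto simp: dilog_zero_domain_iff dilog_cnj cnj_Ln)
  ultimately show ?thesis
    by simp
qed

lemma dilog_zero_exists_unique:
  assumes "B \<noteq> 0" "- \<bar>B\<bar> < 2 * A" "2 * A \<le> \<bar>B\<bar>"
  shows "\<exists>!z. z \<in> dilog_zero_domain \<and>
    dilog z + 4 * (of_real pi)\<^sup>2 * of_int A + 2 * of_real pi * \<i> * of_int B * Ln z = 0"
    (is "\<exists>!z. ?zero B z")
proof -
  have pos: "\<exists>!z. ?zero B z" if B: "0 < B" "- B < 2 * A" "2 * A \<le> B" for B
  proof (rule ex_ex1I)
    show "\<exists>z. ?zero B z"
      using dilog_zero_exists_pos[OF B] by blast
    fix x y assume *: "?zero B x" "?zero B y"
    then have "x \<noteq> 0" "y \<noteq> 0"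
      by (auto simp: dilog_zero_domain_iff)
    moreover have "1 \<le> 2 * real_of_int B"
      using B by linarith
    ultimately show "x = y"
      using * dilog_phase_real_level_unique[of x y "2 * real_of_int B"] dilog_phase_eq_zero_iff
      by blast
  qed
  show ?thesis
  proof (cases "0 < B")
    case True
    with assms show ?thesis by (intro pos) auto
  next
    case False
    have flip: "?zero (- b) (cnj z)" if "?zero b z" for b z
      using that dilog_zero_cnj by (simp only: cnj_in_dilog_zero_domain_iff)
    have "\<exists>!z. ?zero (- B) z"
      using False assms by (intro pos) auto
    then obtain z where z: "?zero (- B) z" and unique: "\<And>y. ?zero (- B) y \<Longrightarrow> y = z"
      by blast
    show ?thesis
    proof (rule ex1I)
      show "?zero B (cnj z)"
        using flip[OF z] by (simp only: minus_minus)
      fix y assume "?zero B y"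
      from unique[OF flip[OF this]] show "y = cnj z"
        by (metis complex_cnj_cnj)
    qed
  qed
qed

section \<open>The saddle strip and the critical points of p_d\<close>

text \<open>The map inverts z -> 1 - e^(2 pi i z). The slit \<open>w \<le> 0\<close> corresponds to
  the removed ray below m, and the slit \<open>w \<ge> 1\<close> is kept out by the strip's vertical
  edges.\<close>

lemma saddle_strip_iff:
  "z \<in> saddle_strip m \<longleftrightarrow> (\<exists>w\<in>dilog_zero_domain. z = of_int m + Ln (1 - w) / (2 * of_real pi * \<i>))"
proof -
  let ?g = "\<lambda>w. of_int m + Ln (1 - w) / (2 * of_real pi * \<i>)"
  have Re_g: "Re (?g w) = of_int m + Im (Ln (1 - w)) / (2 * pi)"
    and Im_g: "Im (?g w) = - Re (Ln (1 - w)) / (2 * pi)" for w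
  proof -
    have "?g w = of_int m + - \<i> * Ln (1 - w) / of_real (2 * pi)"
      by (simp add: field_simps)
    then show "Re (?g w) = of_int m + Im (Ln (1 - w)) / (2 * pi)"
        "Im (?g w) = - Re (Ln (1 - w)) / (2 * pi)"
      by (simp_all only: plus_complex.sel Re_divide_of_real Im_divide_of_real) simp_all
  qed
  have "?g w \<in> saddle_strip m" if w: "w \<in> dilog_zero_domain" for w
  proof -
    have w': "1 - w \<notin> \<real>\<^sub>\<le>\<^sub>0" "1 - w \<noteq> 0"
      using w by (auto simp: dilog_zero_domain_iff)
    have "- pi < Im (Ln (1 - w))" "Im (Ln (1 - w)) < pi"
      using Im_Ln_less_pi[OF w'(1)] mpi_less_Im_Ln[OF w'(2)] by auto
    then have "- (1 / 2) < Im (Ln (1 - w)) / (2 * pi)" "Im (Ln (1 - w)) / (2 * pi) < 1 / 2"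
      by (auto simp: field_simps)
    moreover have "Re (Ln (1 - w)) < 0" if "Im (Ln (1 - w)) = 0"
    proof -
      have "Im w = 0" "Re w < 1"
        using that Im_Ln_eq_0[OF w'(2)] by auto
      then have "norm (1 - w) < 1" "0 < norm (1 - w)"
        using w by (auto simp: cmod_def dilog_zero_domain_iff complex_nonpos_Reals_iff)
      then show ?thesis
        using w' by simp
    qed
    ultimately show ?thesis
      unfolding saddle_strip_def down_ray_def mem_Collect_eq Re_g Im_g
      by (auto simp: divide_le_0_iff zero_le_divide_iff)
  qed
  moreover have "\<exists>w\<in>dilog_zero_domain. z = ?g w" if z: "z \<in> saddle_strip m"
  proof -
    define s where "s = 2 * of_real pi * \<i> * (z - of_int m)"
    have s: "Im s = 2 * pi * (Re z - of_int m)" "Re s = - 2 * pi * Im z"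
      by (simp_all add: s_def)
    have "\<bar>Re z - of_int m\<bar> < 1 / 2"
      using z unfolding saddle_strip_def abs_less_iff by auto
    then have "2 * pi * \<bar>Re z - of_int m\<bar> < 2 * pi * (1 / 2)"
      by (intro mult_strict_left_mono) auto
    then have Im: "\<bar>Im s\<bar> < pi"
      by (simp add: s abs_mult)
    then have Ln: "Ln (exp s) = s"
      by (intro Ln_exp) (auto simp: abs_less_iff)
    have "exp s \<in> dilog_zero_domain"
    proof (cases "Im s = 0")
      case False
      with Im show ?thesis
        by (intro exp_in_dilog_zero_domain) auto
    next
      case True
      then have "0 < Im z"
        using z s by (auto simp: saddle_strip_def down_ray_def)
      then have "Re s < 0"
        by (simp add: s)
      from one_minus_exp_not_nonpos_Reals[OF this] True show ?thesis
        by (simp add: dilog_zero_domain_iff complex_nonpos_Reals_iff Re_exp Im_exp not_le)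
    qed
    then have "1 - exp s \<in> dilog_zero_domain"
      by (simp only: one_minus_in_dilog_zero_domain_iff)
    moreover have "z = ?g (1 - exp s)"
      by (simp add: Ln) (simp add: s_def)
    ultimately show ?thesis
      by blast
  qed
  ultimately show ?thesis
    by blast
qed

text \<open>Write p_d = N/(2 pi i z). Since e^(2 pi i z) = 1 - w, the derivative of N is 2 pi i
  \<open>Ln w\<close>, so criticality means N = 2 pi i z \<open>Ln w\<close>, which is also the
  claimed value. As m is nonzero, the strip avoids z = 0.\<close>

lemma p_fun_critical_point:
  fixes m d :: int and w :: complex
  defines "z \<equiv> of_int m + Ln (1 - w) / (2 * of_real pi * \<i>)"
  assumes w: "w \<in> dilog_zero_domain" and "m \<noteq> 0"
  shows "deriv (p_fun d) z = 0 \<longleftrightarrow>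
      dilog w + 4 * (of_real pi)\<^sup>2 * of_int d + 2 * of_real pi * \<i> * of_int (- m) * Ln w = 0"
    and "deriv (p_fun d) z = 0 \<Longrightarrow> p_fun d z = Ln w"
proof -
  let ?c = "2 * of_real pi * \<i> :: complex"
  let ?N = "\<lambda>z. - dilog (exp (?c * z)) + dilog 1 + 4 * (of_real pi)\<^sup>2 * of_int d"
  have w': "w \<notin> \<real>\<^sub>\<le>\<^sub>0" "w \<noteq> 0" "1 - w \<noteq> 0"
    using w by (auto simp: dilog_zero_domain_iff)
  have cz: "?c * z = ?c * of_int m + Ln (1 - w)"
    by (simp add: z_def algebra_simps)
  have "z \<in> saddle_strip m"
    using w by (auto simp: saddle_strip_iff z_def)
  then have "\<bar>Re z - of_int m\<bar> < 1 / 2"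
    unfolding saddle_strip_def abs_less_iff by auto
  moreover have "1 \<le> \<bar>real_of_int m\<bar>"
    using \<open>m \<noteq> 0\<close> by linarith
  ultimately have "z \<noteq> 0"
    by auto
  have "exp (?c * of_int m) = 1"
    using exp_integer_2pi[of "of_int m"] by (simp add: mult_ac)
  then have u: "exp (?c * z) = 1 - w"
    using w' by (simp add: cz exp_add)
  have "((\<lambda>z. dilog (exp (?c * z))) has_field_derivative - Ln (1 - exp (?c * z)) * ?c) (at z)"
    by (rule DERIV_chain2[where f = "\<lambda>s. dilog (exp s)", OF dilog_exp_has_field_derivative])
      (use w' u in \<open>auto intro!: derivative_eq_intros\<close>)
  then have "(?N has_field_derivative Ln w * ?c) (at z)"
    unfolding u by (auto intro!: derivative_eq_intros)
  moreover have "((\<lambda>z. ?c * z) has_field_derivative ?c) (at z)"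
    by (auto intro!: derivative_eq_intros)
  moreover have "?c * z \<noteq> 0"
    using \<open>z \<noteq> 0\<close> by simp
  ultimately have "(p_fun d has_field_derivative
      (Ln w * ?c * (?c * z) - ?N z * ?c) / ((?c * z) * (?c * z))) (at z)"
    unfolding p_fun_def[abs_def] by (rule DERIV_divide)
  then have "deriv (p_fun d) z = (Ln w * ?c * (?c * z) - ?N z * ?c) / ((?c * z) * (?c * z))"
    by (rule DERIV_imp_deriv)
  also have "\<dots> = (Ln w * (?c * z) - ?N z) * (?c / ((?c * z) * (?c * z)))"
  proof -
    have "(a * b * t - n * b) / q = (a * t - n) * (b / q)" for a b t n q :: complex
      by (simp add: algebra_simps diff_divide_distrib)
    then show ?thesis .
  qed
  finally have crit: "deriv (p_fun d) z = 0 \<longleftrightarrow> Ln w * (?c * z) - ?N z = 0"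
    using \<open>z \<noteq> 0\<close> by simp
  have "dilog (1 - w) = dilog 1 - dilog w - Ln w * Ln (1 - w)"
    using dilog_reflection[OF w] by (simp add: algebra_simps)
  \<comment> \<open>The product \<open>Ln w * Ln (1 - w)\<close> from reflection cancels the one in
    \<open>Ln w * (?c * z)\<close>; only the multiple of m survives.\<close>
  then have "Ln w * (?c * z) - ?N z =
      - (dilog w + 4 * (of_real pi)\<^sup>2 * of_int d + ?c * of_int (- m) * Ln w)"
    unfolding u unfolding cz by (simp add: algebra_simps)
  with crit show "deriv (p_fun d) z = 0 \<longleftrightarrow>
      dilog w + 4 * (of_real pi)\<^sup>2 * of_int d + ?c * of_int (- m) * Ln w = 0"
    by (simp only: neg_equal_0_iff_equal)
  assume "deriv (p_fun d) z = 0"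
  with crit have "?N z = Ln w * (?c * z)"
    by simp
  then show "p_fun d z = Ln w"
    using \<open>?c * z \<noteq> 0\<close> unfolding p_fun_def by simp
qed

theorem theorem2p4:
  fixes m d :: int
  assumes "- \<bar>real_of_int m\<bar> / 2 < real_of_int d" and "real_of_int d \<le> \<bar>real_of_int m\<bar> / 2"
  shows "(\<exists>!z. z \<in> saddle_strip m \<and> deriv (p_fun d) z = 0) \<and>
    (let zs = of_int m + Ln (1 - dilog_zero d (- m)) / (2 * of_real pi * \<i>)
     in zs \<in> saddle_strip m \<and> deriv (p_fun d) zs = 0 \<and> p_fun d zs = Ln (dilog_zero d (- m)))"
proof -
  \<comment> \<open>For m = 0 the bounds would read 0 < d and d <= 0.\<close>
  have "m \<noteq> 0"
    using assms by auto
  define g :: "complex \<Rightarrow> complex" where "g w = of_int m + Ln (1 - w) / (2 * of_real pi * \<i>)" for w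
  let ?zero = "\<lambda>w. w \<in> dilog_zero_domain \<and>
    dilog w + 4 * (of_real pi)\<^sup>2 * of_int d + 2 * of_real pi * \<i> * of_int (- m) * Ln w = 0"
  have "- \<bar>- m\<bar> < 2 * d" "2 * d \<le> \<bar>- m\<bar>"
    using assms by linarith+
  then have ex1: "\<exists>!w. ?zero w"
    using \<open>m \<noteq> 0\<close> by (intro dilog_zero_exists_unique) auto
  then have w: "?zero (dilog_zero d (- m))"
    unfolding dilog_zero_def by (rule theI')
  have strip: "z \<in> saddle_strip m \<longleftrightarrow> (\<exists>w\<in>dilog_zero_domain. z = g w)" for z
    unfolding g_def by (rule saddle_strip_iff)
  have crit: "deriv (p_fun d) (g v) = 0 \<longleftrightarrow> ?zero v" if "v \<in> dilog_zero_domain" for v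
    using p_fun_critical_point(1)[OF that \<open>m \<noteq> 0\<close>, of d] that unfolding g_def by blast
  have zs: "g (dilog_zero d (- m)) \<in> saddle_strip m" "deriv (p_fun d) (g (dilog_zero d (- m))) = 0"
    using w strip crit by blast+
  moreover have "p_fun d (g (dilog_zero d (- m))) = Ln (dilog_zero d (- m))"
    using zs(2) w \<open>m \<noteq> 0\<close> unfolding g_def by (intro p_fun_critical_point(2)) auto
  moreover have "\<exists>!z. z \<in> saddle_strip m \<and> deriv (p_fun d) z = 0"
  proof (rule ex1I)
    \<comment> \<open>Every point of the strip has the form \<open>g v\<close>, so uniqueness of the
      zero \<open>v\<close> passes to z.\<close>
    fix z assume z: "z \<in> saddle_strip m \<and> deriv (p_fun d) z = 0"
    then obtain v where v: "v \<in> dilog_zero_domain" "z = g v"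
      using strip by blast
    with z crit have "?zero v"
      by blast
    with ex1 w have "v = dilog_zero d (- m)"
      by blast
    with v show "z = g (dilog_zero d (- m))"
      by simp
  qed (use zs in blast)
  ultimately show ?thesis
    by (simp only: g_def Let_def simp_thms)
qed

end
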